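(* Let $\delta\in\mathbb C^\times$ and let $(\mathcal A,\ast,\circ)$ be a $\delta$-mock-Novikov-Poisson algebra over $\mathbb C$. For any scalars $\alpha,\beta\in\mathbb C$, define $$x\cdot_{\alpha,\beta}y=\alpha\,x\circ y+\beta\,x\ast y,\qquad x,y\in\mathcal A.$$ Then $(\mathcal A,\cdot_{\alpha,\beta})$ is a $\delta$-mock-Novikov algebra.
   Context: The ground field is $\mathbb C$; an algebra is a vector space with a bilinear product, not necessarily associative. A $\delta$-mock-Novikov algebra is an algebra $(\mathcal A,\circ)$ such that for all $a,b,c\in\mathcal A$ $$\delta(a\circ b)\circ c+\delta(b\circ a)\circ c+a\circ(b\circ c)+b\circ(a\circ c)=0,\qquad (a\circ b)\circ c+(a\circ c)\circ b=0.$$ A $\delta$-mock-Novikov-Poisson algebra is a triple $(\mathcal A,\ast,\circ)$ where $(\mathcal A,\ast)$ is anti-commutative ($x\ast y=-y\ast x$) and anti-associative ($(x\ast y)\ast z=-x\ast(y\ast z)$), $(\mathcal A,\circ)$ is a $\delta$-mock-Novikov algebra, and for all $x,y,z\in\mathcal A$ $$(x\ast y)\circ z+x\ast(y\circ z)=0,$$ $$\delta(x\circ y)\ast z+\delta(y\circ x)\ast z+x\circ(y\ast z)+y\circ(x\ast z)=0.$$ *)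

theory Defs
  imports Complex_Main
begin

text \<open>
  An algebra is a complex vector space (on a whole type, with explicit scalar multiplication)
  with a bilinear product; no associativity, commutativity or unit is assumed.
\<close>

locale complex_algebra = vector_space scale
  for scale :: "complex \<Rightarrow> 'a::ab_group_add \<Rightarrow> 'a" (infixr \<open>*s\<close> 75) +
  fixes mult :: "'a \<Rightarrow> 'a \<Rightarrow> 'a" (infixl \<open>\<odot>\<close> 70)
  assumes linear_right: "Vector_Spaces.linear scale scale (\<lambda>y. x \<odot> y)"
    and linear_left: "Vector_Spaces.linear scale scale (\<lambda>x. x \<odot> y)"

locale mock_Novikov_algebra = complex_algebra scale mult
  for \<delta> :: complex
    and scale :: "complex \<Rightarrow> 'a::ab_group_add \<Rightarrow> 'a" (infixr \<open>*s\<close> 75)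
    and mult :: "'a \<Rightarrow> 'a \<Rightarrow> 'a" (infixl \<open>\<odot>\<close> 70) +
  assumes mock_left_symmetric:
      "\<delta> *s ((a \<odot> b) \<odot> c) + \<delta> *s ((b \<odot> a) \<odot> c) + a \<odot> (b \<odot> c) + b \<odot> (a \<odot> c) = 0"
    and mock_right_commutative: "(a \<odot> b) \<odot> c + (a \<odot> c) \<odot> b = 0"

locale mock_Novikov_Poisson_algebra =
  star: complex_algebra scale star + mock_Novikov_algebra \<delta> scale circ
  for \<delta> :: complex
    and scale :: "complex \<Rightarrow> 'a::ab_group_add \<Rightarrow> 'a" (infixr \<open>*s\<close> 75)
    and star :: "'a \<Rightarrow> 'a \<Rightarrow> 'a" (infixl \<open>\<star>\<close> 70)
    and circ :: "'a \<Rightarrow> 'a \<Rightarrow> 'a" (infixl \<open>\<odot>\<close> 70) +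
  assumes star_anticommutative: "x \<star> y = - (y \<star> x)"
    and star_antiassociative: "(x \<star> y) \<star> z = - (x \<star> (y \<star> z))"
    and star_circ_compat: "(x \<star> y) \<odot> z + x \<star> (y \<odot> z) = 0"
    and circ_star_compat:
      "\<delta> *s ((x \<odot> y) \<star> z) + \<delta> *s ((y \<odot> x) \<star> z) + x \<odot> (y \<star> z) + y \<odot> (x \<star> z) = 0"

end

theory Submission
  imports Defs
begin

text \<open>
  Expand each identity of the new product by bilinearity and compare coefficients. The
  \<open>\<alpha>\<^sup>2\<close> parts are the axioms of \<open>\<circ>\<close>, and the \<open>\<beta>\<^sup>2\<close> parts vanish because \<open>\<star>\<close> is both anti-commutative
  and anti-associative. The \<open>\<alpha>\<beta>\<close> parts vanish by the two compatibility conditions, since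
  \<open>(x \<star> y) \<circ> z\<close>, and therefore \<open>x \<star> (y \<circ> z)\<close>, is skew-symmetric in \<open>x\<close> and \<open>y\<close>.
\<close>

context complex_algebra
begin

lemma mult_add_left: "(x + y) \<odot> z = x \<odot> z + y \<odot> z"
  using linear_left[of z] by (simp add: Vector_Spaces.linear_iff)

lemma mult_add_right: "x \<odot> (y + z) = x \<odot> y + x \<odot> z"
  using linear_right[of x] by (simp add: Vector_Spaces.linear_iff)

lemma mult_zero_left: "0 \<odot> x = 0"
  using mult_add_left[of 0 0 x] by simp

lemma mult_scale_left: "(c *s x) \<odot> y = c *s (x \<odot> y)"
  using linear_left[of y] by (simp add: Vector_Spaces.linear_iff)

lemma mult_scale_right: "x \<odot> (c *s y) = c *s (x \<odot> y)"
  using linear_right[of x] by (simp add: Vector_Spaces.linear_iff)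

lemmas bilinear_simps = mult_add_left mult_add_right mult_scale_left mult_scale_right

end

text \<open>Bilinear products on a fixed vector space are closed under linear combinations. This
  settles the algebra axioms for the new product, so only its two identities remain.\<close>

lemma complex_algebra_linear_combination:
  assumes "complex_algebra scale f" and "complex_algebra scale g"
  shows "complex_algebra scale (\<lambda>x y. scale \<alpha> (f x y) + scale \<beta> (g x y))"
proof -
  interpret f: complex_algebra scale f by fact
  interpret g: complex_algebra scale g by fact
  show ?thesis
    by unfold_locales
      (auto simp: f.bilinear_simps g.bilinear_simps f.scale_right_distrib mult.commute add_ac)
qed

context mock_Novikov_Poisson_algebra
begin

lemma star_circ_right: "x \<star> (y \<odot> z) = - ((x \<star> y) \<odot> z)"
  using star_circ_compat[of x y z] by (simp only: eq_neg_iff_add_eq_0 add.commute)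

lemma star_circ_skew: "(x \<star> y) \<odot> z + (y \<star> x) \<odot> z = 0"
proof -
  have "x \<star> y + y \<star> x = 0"
    using star_anticommutative[of x y] by (simp only: eq_neg_iff_add_eq_0)
  then show ?thesis
    by (simp only: mult_add_left[symmetric] mult_zero_left)
qed

lemma star_circ_right_skew: "x \<star> (y \<odot> z) + y \<star> (x \<odot> z) = 0"
  unfolding star_circ_right minus_add_distrib[symmetric] star_circ_skew by (rule minus_zero)

text \<open>Anti-commutativity moves \<open>x \<odot> y\<close> to the right of \<open>z\<close>,
  and compatibility then extracts \<open>y\<close>. Each move costs a sign, so
  \<open>(x \<odot> y) \<star> z\<close> equals \<open>(z \<star> x) \<odot> y\<close>, and
  skew-symmetry finishes. This handles the mixed terms of the right-commutative identity.\<close>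

lemma circ_star_right: "(x \<odot> y) \<star> z + (x \<star> z) \<odot> y = 0"
proof -
  have "(x \<odot> y) \<star> z = (z \<star> x) \<odot> y"
    by (simp only: star_anticommutative[of "x \<odot> y" z] star_circ_right minus_minus)
  then show ?thesis
    by (simp only: star_circ_skew)
qed

lemma star_skew: "(x \<star> y) \<star> z + (y \<star> x) \<star> z = 0"
proof -
  have "x \<star> y + y \<star> x = 0"
    using star_anticommutative[of x y] by (simp only: eq_neg_iff_add_eq_0)
  then show ?thesis
    by (simp only: star.mult_add_left[symmetric] star.mult_zero_left)
qed

lemma star_right_skew: "x \<star> (y \<star> z) + y \<star> (x \<star> z) = 0"
  using star_skew[of x y z]
  by (simp only: star_antiassociative minus_add_distrib[symmetric] neg_equal_0_iff_equal)

text \<open>The same two sign changes as in \<open>circ_star_right\<close>, with anti-associativity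
  in place of compatibility.\<close>

lemma star_right_commutative: "(x \<star> y) \<star> z + (x \<star> z) \<star> y = 0"
proof -
  have "(x \<star> y) \<star> z = (z \<star> x) \<star> y"
    by (simp only: star_anticommutative[of "x \<star> y" z] star_antiassociative[of z x y])
  then show ?thesis
    by (simp only: star_skew)
qed

end

theorem proposition6p2:
  fixes \<delta> \<alpha> \<beta> :: complex
    and scale :: "complex \<Rightarrow> 'a::ab_group_add \<Rightarrow> 'a"
    and star circ :: "'a \<Rightarrow> 'a \<Rightarrow> 'a"
  assumes "\<delta> \<noteq> 0"
    and "mock_Novikov_Poisson_algebra \<delta> scale star circ"
  shows "mock_Novikov_algebra \<delta> scale
           (\<lambda>x y. scale \<alpha> (circ x y) + scale \<beta> (star x y))"
proof -
  interpret mock_Novikov_Poisson_algebra \<delta> scale star circ by fact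
  define p where "p = (\<lambda>x y. scale \<alpha> (circ x y) + scale \<beta> (star x y))"
  interpret p: complex_algebra scale p
    unfolding p_def
    by (intro complex_algebra_linear_combination complex_algebra_axioms star.complex_algebra_axioms)
  note expand = p_def star.scale_scale bilinear_simps star.bilinear_simps star.scale_right_distrib
  \<comment> \<open>Collecting by degree in \<alpha> and \<beta> reduces each identity to one
    condition per monomial.\<close>
  have left: "p (p a b) c = scale (\<alpha> * \<alpha>) (circ (circ a b) c)
      + scale (\<alpha> * \<beta>) (circ (star a b) c + star (circ a b) c)
      + scale (\<beta> * \<beta>) (star (star a b) c)" for a b c
    by (simp add: expand mult.commute add_ac)
  have right: "p a (p b c) = scale (\<alpha> * \<alpha>) (circ a (circ b c))
      + scale (\<alpha> * \<beta>) (circ a (star b c) + star a (circ b c))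
      + scale (\<beta> * \<beta>) (star a (star b c))" for a b c
    by (simp add: expand mult.commute add_ac)
  have "mock_Novikov_algebra \<delta> scale p"
  proof unfold_locales
    fix a b c
    \<comment> \<open>The mixed part splits into three sums that vanish separately: the left side of
      \<open>circ_star_compat\<close>, \<delta> times that of \<open>star_circ_skew\<close>, and
      that of \<open>star_circ_right_skew\<close>.\<close>
    have "scale \<delta> (p (p a b) c) + scale \<delta> (p (p b a) c) + p a (p b c) + p b (p a c)
      = scale (\<alpha> * \<alpha>) (scale \<delta> (circ (circ a b) c) + scale \<delta> (circ (circ b a) c)
          + circ a (circ b c) + circ b (circ a c))
      + scale (\<alpha> * \<beta>) ((scale \<delta> (star (circ a b) c) + scale \<delta> (star (circ b a) c)
          + circ a (star b c) + circ b (star a c))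
          + scale \<delta> (circ (star a b) c + circ (star b a) c)
          + (star a (circ b c) + star b (circ a c)))
      + scale (\<beta> * \<beta>) (scale \<delta> (star (star a b) c + star (star b a) c)
          + (star a (star b c) + star b (star a c)))"
      unfolding left right by (simp add: star.scale_right_distrib mult_ac add_ac)
    then show "scale \<delta> (p (p a b) c) + scale \<delta> (p (p b a) c) + p a (p b c) + p b (p a c) = 0"
      by (simp only: mock_left_symmetric circ_star_compat star_circ_skew star_circ_right_skew
          star_skew star_right_skew star.scale_zero_right add_0_left)
  next
    fix a b c
    \<comment> \<open>The four mixed terms are paired crosswise, one from each product, giving two
      instances of \<open>circ_star_right\<close> with \<open>b\<close> and \<open>c\<close>
      exchanged.\<close>
    have "p (p a b) c + p (p a c) b
      = scale (\<alpha> * \<alpha>) (circ (circ a b) c + circ (circ a c) b)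
      + scale (\<alpha> * \<beta>) ((star (circ a b) c + circ (star a c) b)
          + (star (circ a c) b + circ (star a b) c))
      + scale (\<beta> * \<beta>) (star (star a b) c + star (star a c) b)"
      unfolding left by (simp add: star.scale_right_distrib add_ac)
    then show "p (p a b) c + p (p a c) b = 0"
      by (simp only: mock_right_commutative circ_star_right star_right_commutative
          star.scale_zero_right add_0_left)
  qed
  then show ?thesis
    unfolding p_def .
qed

end
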